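(* There exists a Jordan-Krylov basis $\mathcal{B}$ of $\ker f(A)^{\bar\ell}$ with respect to $A$. Furthermore, for each $\ell$ with $1\le\ell\le\bar\ell$, the number of elements $\mathbf{b}\in\mathcal{B}$ with $\operatorname{rank}_f\mathbf{b}=\ell$ is uniquely determined (it is the same for every Jordan-Krylov basis of $\ker f(A)^{\bar\ell}$).
   Context: Let $K\subset\mathbb{C}$ be a subfield, $A$ an $n\times n$ matrix over $K$, and $f(\lambda)\in K[\lambda]$ a monic irreducible factor of the characteristic polynomial of $A$. Let $\bar\ell$ be the multiplicity of $f$ in the minimal polynomial of $A$. For $1\le\ell\le\bar\ell$, $\ker f(A)^\ell=\{\mathbf{u}\in K^n\mid f(A)^\ell\mathbf{u}=\mathbf{0}\}$, and $\ker f(A)^0=\{\mathbf{0}\}$. For nonzero $\mathbf{u}\in\ker f(A)^{\bar\ell}$, $\operatorname{rank}_f\mathbf{u}=\ell$ means $\mathbf{u}\in\ker f(A)^\ell\setminus\ker f(A)^{\ell-1}$. For $\mathbf{w}\in K^n$, the Krylov vector space is $L_A(\mathbf{w})=\operatorname{span}_K\{A^k\mathbf{w}\mid k=0,1,2,\ldots\}$. Vector spaces $V_1,\ldots,V_r$ satisfy the direct sum condition if $(V_1+\cdots+V_{i-1}+V_{i+1}+\cdots+V_r)\cap V_i=\{\mathbf{0}\}$ for $i=1,\ldots,r$. Let $W$ be a subspace of $K^n$. A subset $\mathcal{W}\subset W$ is a Krylov generating set of $W$ (with respect to $A$) if $W=\sum_{\mathbf{w}\in\mathcal{W}}L_A(\mathbf{w})$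 (the empty set is a Krylov generating set of $\{\mathbf{0}\}$). A finite set $\mathcal{W}$ of vectors is Jordan-Krylov independent (with respect to $A$) if the family of Krylov vector spaces $L_A(\mathbf{w})$, indexed by $\mathbf{w}\in\mathcal{W}$, satisfies the direct sum condition (the empty set is Jordan-Krylov independent). A Jordan-Krylov basis of $W$ is a finite Krylov generating set of $W$ that is Jordan-Krylov independent. *)

theory Defs
  imports
    "HOL-Analysis.Analysis"
    "HOL-Computational_Algebra.Computational_Algebra"
begin

(* A subfield K of the complex numbers is presented as a field type together with an
   embedding into complex; the subfield itself is the range of the embedding. *)

definition complex_field_embedding :: "('k::field \<Rightarrow> complex) \<Rightarrow> bool" where
  "complex_field_embedding \<iota> \<longleftrightarrow>
     inj \<iota> \<and> \<iota> 1 = 1 \<and>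
     (\<forall>x y. \<iota> (x + y) = \<iota> x + \<iota> y) \<and>
     (\<forall>x y. \<iota> (x * y) = \<iota> x * \<iota> y)"

(* The class operations * and ^ on 'k^'n^'n act componentwise, so powers with respect to
   the matrix product have to be introduced separately. *)

definition matrix_power :: "'k::semiring_1^'n^'n \<Rightarrow> nat \<Rightarrow> 'k^'n^'n" where
  "matrix_power A k = (((**) A) ^^ k) (mat 1)"

(* mat c is the scalar matrix c I, so mat c ** M is the multiple c M. *)

definition poly_matrix :: "'k::comm_ring_1 poly \<Rightarrow> 'k^'n^'n \<Rightarrow> 'k^'n^'n" where
  "poly_matrix p A = (\<Sum>i\<le>degree p. mat (coeff p i) ** matrix_power A i)"

definition charpoly :: "'k::comm_ring_1^'n^'n \<Rightarrow> 'k poly" where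
  "charpoly A = det (mat [:0, 1:] - (\<chi> i j. [:A $ i $ j:]))"

(* The monic annihilating polynomial of least degree. It exists since the matrices form a
   finite-dimensional space, and it is unique since the difference of two candidates is an
   annihilating polynomial of smaller degree. *)

definition minpoly :: "'k::field^'n^'n \<Rightarrow> 'k poly" where
  "minpoly A = (THE p. lead_coeff p = 1 \<and> poly_matrix p A = 0 \<and>
     (\<forall>q. q \<noteq> 0 \<and> poly_matrix q A = 0 \<longrightarrow> degree p \<le> degree q))"

(* The library's multiplicity needs a class with normalization, to which polynomials over an
   arbitrary field do not belong. The set below is finite for nonzero p and nonconstant f. *)

definition factor_multiplicity :: "'k::field poly \<Rightarrow> 'k poly \<Rightarrow> nat" where
  "factor_multiplicity f p = Max {l. f ^ l dvd p}"

(* ker f(A)^l *)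

definition ker_pow :: "'k::field^'n^'n \<Rightarrow> 'k poly \<Rightarrow> nat \<Rightarrow> ('k^'n) set" where
  "ker_pow A f l = {u. matrix_power (poly_matrix f A) l *v u = 0}"

(* rank_f u = l, for l \<ge> 1. The zero vector has no rank, as it lies in every kernel. *)

definition has_rank :: "'k::field^'n^'n \<Rightarrow> 'k poly \<Rightarrow> 'k^'n \<Rightarrow> nat \<Rightarrow> bool" where
  "has_rank A f u l \<longleftrightarrow> u \<in> ker_pow A f l - ker_pow A f (l - 1)"

definition krylov_space :: "'k::field^'n^'n \<Rightarrow> 'k^'n \<Rightarrow> ('k^'n) set" where
  "krylov_space A w = vec.span {matrix_power A k *v w | k. True}"

(* The sum of a possibly infinite family consists of the sums of finitely many members;
   the empty sum is {0}. *)

definition family_sum :: "'i set \<Rightarrow> ('i \<Rightarrow> 'v::comm_monoid_add set) \<Rightarrow> 'v set" where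
  "family_sum I V =
     {\<Sum>i\<in>J. v i | J v. finite J \<and> J \<subseteq> I \<and> (\<forall>i\<in>J. v i \<in> V i)}"

definition direct_sum_condition :: "'i set \<Rightarrow> ('i \<Rightarrow> 'v::comm_monoid_add set) \<Rightarrow> bool" where
  "direct_sum_condition I V \<longleftrightarrow> (\<forall>i\<in>I. family_sum (I - {i}) V \<inter> V i = {0})"

definition krylov_generating :: "'k::field^'n^'n \<Rightarrow> ('k^'n) set \<Rightarrow> ('k^'n) set \<Rightarrow> bool" where
  "krylov_generating A W S \<longleftrightarrow> S \<subseteq> W \<and> W = family_sum S (krylov_space A)"

definition jordan_krylov_independent :: "'k::field^'n^'n \<Rightarrow> ('k^'n) set \<Rightarrow> bool" where
  "jordan_krylov_independent A S \<longleftrightarrow> finite S \<and> direct_sum_condition S (krylov_space A)"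

definition jordan_krylov_basis :: "'k::field^'n^'n \<Rightarrow> ('k^'n) set \<Rightarrow> ('k^'n) set \<Rightarrow> bool" where
  "jordan_krylov_basis A W B \<longleftrightarrow>
     finite B \<and> krylov_generating A W B \<and> jordan_krylov_independent A B"

end

(* A makes K^n a module over K[x], and Krylov spaces are its cyclic submodules. A basis of
   M = ker f(A)^L is built by induction on L: lift a basis of f(A) M along f(A), then enlarge it
   by vectors of ker f(A). For uniqueness, if b has rank r, then f(A)^j L_A(b) has dimension
   deg f * max (r - j) 0; hence dim f(A)^j M determines the sum of max (r - j) 0 over the basis
   for every j, and the number of elements of rank l is a second difference of these sums. *)
theory Submission
  imports Defs
begin

section \<open>The module structure given by a matrix\<close>

text \<open>This is scalar multiplication for the K[x]-module structure on K^n. Written on vectors,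
  it lets commutativity of K[x] be used directly (\<open>act_commute\<close>).\<close>

definition act :: "'k::field^'n^'n \<Rightarrow> 'k poly \<Rightarrow> 'k^'n \<Rightarrow> 'k^'n" where
  "act A p v = poly_matrix p A *v v"

lemma matrix_power_0 [simp]: "matrix_power A 0 = mat 1"
  by (simp add: matrix_power_def)

lemma matrix_power_Suc [simp]: "matrix_power A (Suc k) = A ** matrix_power A k"
  by (simp add: matrix_power_def)

lemma matrix_vector_mult_sum_left: "(\<Sum>i\<in>I. M i) *v v = (\<Sum>i\<in>I. M i *v (v :: 'k::field^'n))"
  by (induction I rule: infinite_finite_induct) (auto simp: matrix_vector_mult_add_rdistrib)

lemma mat_mult_vector: "mat c *v v = c *s (v :: 'k::field^'n)"
  by (auto simp: vec_eq_iff mat_def matrix_vector_mult_def if_distrib if_distribR cong: if_cong)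

text \<open>The upper limit is any bound on the degree, so that polynomials of different degrees can
  be expanded over one index range.\<close>

lemma act_eq_sum:
  assumes "degree p \<le> n"
  shows "act A p v = (\<Sum>i\<le>n. coeff p i *s (matrix_power A i *v v))"
proof -
  have "act A p v = (\<Sum>i\<le>degree p. coeff p i *s (matrix_power A i *v v))"
    by (simp add: act_def poly_matrix_def matrix_vector_mult_sum_left mat_mult_vector
        flip: matrix_vector_mul_assoc)
  also have "\<dots> = (\<Sum>i\<le>n. coeff p i *s (matrix_power A i *v v))"
    using assms by (intro sum.mono_neutral_left) (auto simp: coeff_eq_0)
  finally show ?thesis .
qed

lemma act_0_left [simp]: "act A 0 v = 0"
  by (simp add: act_eq_sum[of 0 0])

lemma act_0_right [simp]: "act A p 0 = 0"
  by (simp add: act_def)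

lemma act_add_right: "act A p (v + w) = act A p v + act A p w"
  by (simp add: act_def matrix_vector_right_distrib)

lemma act_diff_right: "act A p (v - w) = act A p v - act A p w"
  by (simp add: act_def matrix_vector_mult_diff_distrib)

lemma act_sum_right: "act A p (\<Sum>i\<in>I. g i) = (\<Sum>i\<in>I. act A p (g i))"
  by (induction I rule: infinite_finite_induct) (auto simp: act_add_right)

lemma act_add_left: "act A (p + q) v = act A p v + act A q v"
proof -
  let ?n = "max (degree p) (degree q)"
  have "degree (p + q) \<le> ?n"
    by (rule degree_add_le_max)
  then show ?thesis
    by (simp add: act_eq_sum[of _ ?n] vec.scale_left_distrib sum.distrib)
qed

lemma act_sum_left: "act A (\<Sum>i\<in>I. p i) v = (\<Sum>i\<in>I. act A (p i) v)"
  by (induction I rule: infinite_finite_induct) (auto simp: act_add_left)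

lemma act_smult: "act A (smult c p) v = c *s act A p v"
  by (simp add: act_eq_sum[of _ "degree p"] degree_smult_le vec.scale_sum_right)

lemma act_uminus_left: "act A (- p) v = - act A p v"
  using act_smult[of A "-1" p v] by simp

lemma act_diff_left: "act A (p - q) v = act A p v - act A q v"
  using act_add_left[of A p "- q" v] by (simp add: act_uminus_left)

text \<open>Horner's rule; it supports inductions over the coefficient list, in particular
  multiplicativity in \<open>act_mult\<close>.\<close>

lemma act_pCons: "act A (pCons a p) v = a *s v + A *v act A p v"
proof -
  have "act A (pCons a p) v =
      (\<Sum>i\<le>Suc (degree p). coeff (pCons a p) i *s (matrix_power A i *v v))"
    by (rule act_eq_sum) (simp add: degree_pCons_le)
  also have "\<dots> = a *s v + (\<Sum>i\<le>degree p. coeff p i *s (A *v (matrix_power A i *v v)))"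
    unfolding sum.atMost_Suc_shift by (simp add: matrix_vector_mul_assoc)
  also have "(\<Sum>i\<le>degree p. coeff p i *s (A *v (matrix_power A i *v v))) = A *v act A p v"
    by (simp add: act_eq_sum[of p "degree p"] vec.scale vec.sum)
  finally show ?thesis .
qed

lemma act_mult: "act A (p * q) v = act A p (act A q v)"
proof (induction p)
  case 0
  then show ?case by simp
next
  case (pCons a p)
  then show ?case by (simp add: act_add_left act_smult act_pCons)
qed

lemma act_1 [simp]: "act A 1 v = v"
  using act_pCons[of A 1 0 v] by (simp add: one_pCons)

lemma act_power_act: "act A (f ^ m) (act A f v) = act A (f ^ Suc m) v"
  by (metis act_mult power_Suc2)

lemma act_const: "act A [:c:] v = c *s v"
  by (simp add: act_pCons)

lemma act_commute: "act A p (act A q v) = act A q (act A p v)"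
  by (metis act_mult mult.commute)

lemma act_monom: "act A (monom c k) v = c *s (matrix_power A k *v v)"
proof (induction k)
  case 0
  then show ?case by (simp add: monom_0 act_const)
next
  case (Suc k)
  then show ?case by (simp add: monom_Suc act_pCons vec.scale matrix_vector_mul_assoc)
qed

lemma matrix_power_poly_matrix: "matrix_power (poly_matrix f A) l *v v = act A (f ^ l) v"
proof (induction l)
  case 0
  then show ?case by simp
next
  case (Suc l)
  then show ?case
    by (simp add: act_mult flip: matrix_vector_mul_assoc) (simp add: act_def)
qed

lemma mem_ker_pow_iff: "v \<in> ker_pow A f l \<longleftrightarrow> act A (f ^ l) v = 0"
  by (simp add: ker_pow_def matrix_power_poly_matrix)

section \<open>Submodules, and Krylov spaces as cyclic submodules\<close>

definition submodule :: "'k::field^'n^'n \<Rightarrow> ('k^'n) set \<Rightarrow> bool" where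
  "submodule A M \<longleftrightarrow>
     0 \<in> M \<and> (\<forall>v\<in>M. \<forall>w\<in>M. v + w \<in> M) \<and> (\<forall>p. \<forall>v\<in>M. act A p v \<in> M)"

lemma submodule_imp_subspace: "submodule A M \<Longrightarrow> vec.subspace M"
  unfolding submodule_def vec.subspace_def by (metis act_const)

lemma submodule_sum:
  "submodule A M \<Longrightarrow> (\<And>i. i \<in> I \<Longrightarrow> g i \<in> M) \<Longrightarrow> (\<Sum>i\<in>I. g i) \<in> M"
  by (induction I rule: infinite_finite_induct) (auto simp: submodule_def)

lemma submodule_ker_pow: "submodule A (ker_pow A f l)"
  by (auto simp: submodule_def mem_ker_pow_iff act_add_right act_commute[of A "f ^ l"])

lemma submodule_act_image: "submodule A M \<Longrightarrow> submodule A (act A p ` M)"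
  unfolding submodule_def
  by (auto simp flip: act_add_right simp: act_commute[of A _ p] intro: image_eqI[of _ _ 0])

text \<open>Monomials act as multiples of powers of A, so linear combinations of the iterates of w
  are exactly its polynomial multiples.\<close>

lemma krylov_space_eq: "krylov_space A w = range (\<lambda>p. act A p w)"
proof
  have "vec.subspace (range (\<lambda>p. act A p w))"
    unfolding vec.subspace_def
    by (auto simp flip: act_add_left act_smult intro: range_eqI[of _ _ 0])
  moreover have "matrix_power A k *v w \<in> range (\<lambda>p. act A p w)" for k
    by (rule range_eqI[of _ _ "monom 1 k"]) (simp add: act_monom)
  ultimately show "krylov_space A w \<subseteq> range (\<lambda>p. act A p w)"
    unfolding krylov_space_def by (intro vec.span_minimal) auto
next
  have "act A p w \<in> krylov_space A w" for p
    unfolding act_eq_sum[OF order_refl] krylov_space_def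
    by (intro vec.span_sum vec.span_scale vec.span_base) blast
  then show "range (\<lambda>p. act A p w) \<subseteq> krylov_space A w"
    by blast
qed

section \<open>Primary vectors\<close>

text \<open>A nonzero element g of least degree in the ideal generated by p and f divides both.
  Being a divisor of the irreducible f, it is a unit or an associate of f, and the latter would
  force f to divide p.\<close>

lemma irreducible_bezout:
  fixes f p :: "'k::field poly"
  assumes "irreducible f" and "\<not> f dvd p"
  obtains a b where "a * p + b * f = 1"
proof -
  define I where "I = {a * p + b * f | a b. True}"
  have "f \<in> I"
    unfolding I_def by (rule CollectI, rule exI[of _ 0], rule exI[of _ 1]) simp
  moreover have "f \<noteq> 0"
    using assms(1) by auto
  ultimately obtain g where g: "g \<in> I" "g \<noteq> 0"
    and min: "\<And>h. h \<in> I \<Longrightarrow> h \<noteq> 0 \<Longrightarrow> degree g \<le> degree h"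
    using ex_has_least_nat[of "\<lambda>h. h \<in> I \<and> h \<noteq> 0" f degree] by blast
  obtain a b where ab: "g = a * p + b * f"
    using g(1) by (auto simp: I_def)
  \<comment> \<open>The remainder of h modulo g stays in the ideal and has smaller degree than g, so
    minimality forces it to be zero.\<close>
  have dvd: "g dvd h" if h: "h \<in> I" for h
  proof (rule ccontr)
    assume "\<not> g dvd h"
    then have "h mod g \<noteq> 0" by (simp add: dvd_eq_mod_eq_0)
    then have "degree (h mod g) < degree g"
      using g(2) degree_mod_less'[of g h] by simp
    moreover have "h mod g \<in> I"
    proof -
      obtain c d where "h = c * p + d * f"
        using h unfolding I_def by blast
      then have "h mod g = (c - h div g * a) * p + (d - h div g * b) * f"
        by (simp add: minus_div_mult_eq_mod[symmetric] ab algebra_simps)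
      then show ?thesis by (auto simp: I_def)
    qed
    ultimately show False
      using min \<open>h mod g \<noteq> 0\<close> by fastforce
  qed
  have "p \<in> I"
    unfolding I_def by (rule CollectI, rule exI[of _ 1], rule exI[of _ 0]) simp
  then have "g dvd p" by (rule dvd)
  obtain h where h: "f = g * h"
    using dvd[OF \<open>f \<in> I\<close>] by auto
  have "\<not> is_unit h"
  proof
    assume "is_unit h"
    then have "f dvd g" by (simp add: h mult_unit_dvd_iff)
    then show False using \<open>g dvd p\<close> assms(2) dvd_trans by blast
  qed
  then have "is_unit g"
    using assms(1) h irreducibleD by blast
  then obtain k where "1 = g * k" by auto
  then have "(k * a) * p + (k * b) * f = 1"
    by (simp add: ab algebra_simps)
  then show ?thesis by (rule that)
qed

text \<open>If f did not divide p, Bezout would give 1 as a combination of p and f, and a vector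
  killed by both would vanish. Induction on m reduces to that case.\<close>

lemma primary_annihilator:
  assumes "irreducible f" and "act A (f ^ m) w = 0" and "act A p w = 0" and "w \<noteq> 0"
  shows "f dvd p"
proof (rule ccontr)
  assume "\<not> f dvd p"
  then obtain a b where ab: "a * p + b * f = 1"
    using irreducible_bezout[OF assms(1)] by blast
  have "w = 0" if "act A (f ^ m) w = 0" "act A p w = 0" for w
    using that
  proof (induction m arbitrary: w)
    case 0
    then show ?case by simp
  next
    case (Suc m)
    \<comment> \<open>The vector f(A) w is still killed by p, and by one power of f fewer.\<close>
    have "act A f w = 0"
    proof (rule Suc.IH)
      show "act A (f ^ m) (act A f w) = 0"
        using Suc.prems(1) by (simp only: act_power_act)
      show "act A p (act A f w) = 0"
        using Suc.prems(2) by (simp only: act_commute[of A p f] act_0_right)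
    qed
    then have "act A (a * p + b * f) w = 0"
      using Suc.prems by (simp add: act_add_left act_mult)
    then show ?case by (simp add: ab)
  qed
  then show False using assms by blast
qed

text \<open>With \<open>primary_annihilator\<close>, factors f are split off p one at a time: if p =
  f^s q with s \<le> r, then q kills the nonzero vector f(A)^s w.\<close>

lemma primary_annihilator_power:
  assumes "irreducible f" and "act A (f ^ Suc r) w = 0" and "act A (f ^ r) w \<noteq> 0"
    and "act A p w = 0"
  shows "f ^ Suc r dvd p"
proof -
  have "f ^ s dvd p" if "s \<le> Suc r" for s
    using that
  proof (induction s)
    case 0
    then show ?case by simp
  next
    case (Suc s)
    then obtain q where q: "p = f ^ s * q" by auto
    have "f ^ r = f ^ (r - s) * f ^ s"
      using Suc.prems by (simp flip: power_add)
    then have "act A (f ^ s) w \<noteq> 0"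
      using assms(3) by (auto simp: act_mult)
    moreover have "act A q (act A (f ^ s) w) = 0"
      using assms(4) by (simp add: q mult.commute flip: act_mult)
    moreover have "act A (f ^ Suc r) (act A (f ^ s) w) = 0"
      unfolding act_commute[of A "f ^ Suc r"] assms(2) by simp
    ultimately have "f dvd q"
      using primary_annihilator[OF assms(1)] by blast
    then show ?case
      by (simp add: q mult.commute mult_dvd_mono)
  qed
  then show ?thesis by blast
qed

lemma coeff_sum_monom_lessThan:
  assumes "i < m"
  shows "coeff (\<Sum>k<m. monom (u k) k) i = u i"
  using assms by (simp add: coeff_sum coeff_monom)

text \<open>The Krylov space is K[x] modulo f^(r+1). The iterates A^k w with k < m form a basis,
  where m is the degree of f^(r+1): independent since no nonzero polynomial of smaller degree kills
  w, spanning by division with remainder.\<close>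

lemma dim_krylov_space:
  assumes f: "irreducible f" and w: "act A (f ^ Suc r) w = 0" "act A (f ^ r) w \<noteq> 0"
  shows "vec.dim (krylov_space A w) = degree f * Suc r"
proof -
  define m where "m = degree (f ^ Suc r)"
  have "f \<noteq> 0" using f by auto
  then have m: "m = degree f * Suc r"
    unfolding m_def by (metis degree_power_eq mult.commute)
  have "f ^ Suc r \<noteq> 0" using \<open>f \<noteq> 0\<close> by simp
  have "degree f \<noteq> 0"
    using f \<open>f \<noteq> 0\<close> by (auto simp: irreducible_def is_unit_iff_degree)
  \<comment> \<open>The zero polynomial has degree 0, so the strict degree bounds below rely on m
    being positive.\<close>
  then have "m > 0" by (simp add: m)
  have small: "p = 0" if "degree p < m" "act A p w = 0" for p
    using dvd_imp_degree_le[OF primary_annihilator_power[OF f w that(2)]] that(1)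
    unfolding m_def by linarith
  define e where "e k = matrix_power A k *v w" for k
  have act_sum: "act A (\<Sum>k<m. monom (u k) k) w = (\<Sum>k<m. u k *s e k)" for u
    by (simp add: act_sum_left act_monom e_def)
  have deg_sum: "degree (\<Sum>k<m. monom (u k) k) < m" for u :: "nat \<Rightarrow> 'a"
    using \<open>m > 0\<close>
    by (intro degree_lessI) (auto simp: coeff_sum coeff_monom intro!: sum.neutral)
  \<comment> \<open>Independence concerns the set of iterates; injectivity turns a relation over
    that set into one indexed by exponents.\<close>
  have inj: "inj_on e {..<m}"
  proof (rule inj_onI)
    fix i j assume ij: "i \<in> {..<m}" "j \<in> {..<m}" "e i = e j"
    have "degree (monom 1 i - monom 1 j :: 'a poly) \<le> max i j"
      by (rule degree_diff_le) (auto intro: order_trans[OF degree_monom_le])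
    then have "monom 1 i - monom 1 j = (0 :: 'a poly)"
      using ij by (intro small) (auto simp: act_diff_left act_monom e_def)
    then show "i = j"
      by (simp add: monom_eq_iff')
  qed
  have "vec.independent (e ` {..<m})"
  proof
    assume "vec.dependent (e ` {..<m})"
    then obtain u v where v: "v \<in> e ` {..<m}" "u v \<noteq> 0"
      and "(\<Sum>v\<in>e ` {..<m}. u v *s v) = 0"
      by (auto simp: vec.dependent_finite)
    then have "(\<Sum>k<m. u (e k) *s e k) = 0"
      by (simp add: sum.reindex[OF inj])
    then have "(\<Sum>k<m. monom (u (e k)) k) = 0"
      using act_sum[of "\<lambda>k. u (e k)"] deg_sum[of "\<lambda>k. u (e k)"] by (intro small) auto
    then have "coeff (\<Sum>k<m. monom (u (e k)) k) i = 0" for i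
      by simp
    then have "u (e i) = 0" if "i < m" for i
      using that coeff_sum_monom_lessThan by metis
    then show False using v by auto
  qed
  moreover have "krylov_space A w = vec.span (e ` {..<m})"
  proof
    show "vec.span (e ` {..<m}) \<subseteq> krylov_space A w"
      unfolding krylov_space_def by (intro vec.span_mono) (auto simp: e_def)
    show "krylov_space A w \<subseteq> vec.span (e ` {..<m})"
    proof
      fix v assume "v \<in> krylov_space A w"
      then obtain p where p: "v = act A p w"
        by (auto simp: krylov_space_eq)
      \<comment> \<open>Since f^(r+1) kills w, only the remainder of p acts.\<close>
      have "act A (p div f ^ Suc r * f ^ Suc r + p mod f ^ Suc r) w = act A (p mod f ^ Suc r) w"
        using w(1) by (simp only: act_add_left act_mult act_0_right add_0_left)
      then have v: "v = act A (p mod f ^ Suc r) w"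
        by (simp only: p div_mult_mod_eq)
      have "degree (p mod f ^ Suc r) < m"
        using degree_mod_less[OF \<open>f ^ Suc r \<noteq> 0\<close>, of p] \<open>m > 0\<close> by (auto simp: m_def)
      then have "v = (\<Sum>k\<le>m - 1. coeff (p mod f ^ Suc r) k *s e k)"
        unfolding v e_def by (intro act_eq_sum) simp
      also have "\<dots> \<in> vec.span (e ` {..<m})"
        using \<open>m > 0\<close> by (intro vec.span_sum vec.span_scale vec.span_base) auto
      finally show "v \<in> vec.span (e ` {..<m})" .
    qed
  qed
  ultimately have "vec.dim (krylov_space A w) = card (e ` {..<m})"
    by (simp add: vec.dim_eq_card_independent)
  also have "\<dots> = degree f * Suc r"
    using card_image[OF inj] by (simp only: card_lessThan m)
  finally show ?thesis .
qed

section \<open>Sums of Krylov spaces\<close>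

text \<open>Generators form an indexed family, so that each can be replaced by its image under a
  polynomial even when images coincide or vanish.\<close>

definition krylov_sum :: "'k::field^'n^'n \<Rightarrow> 'i set \<Rightarrow> ('i \<Rightarrow> 'k^'n) \<Rightarrow> ('k^'n) set" where
  "krylov_sum A I g = range (\<lambda>c. \<Sum>i\<in>I. act A (c i) (g i))"

text \<open>Only the terms of a relation must vanish, not the coefficients: every vector has nonzero
  annihilating polynomials. This expresses directness of the sum of cyclic submodules, and zero
  generators are allowed.\<close>

definition krylov_indep :: "'k::field^'n^'n \<Rightarrow> 'i set \<Rightarrow> ('i \<Rightarrow> 'k^'n) \<Rightarrow> bool" where
  "krylov_indep A I g \<longleftrightarrow>
     (\<forall>c. (\<Sum>i\<in>I. act A (c i) (g i)) = 0 \<longrightarrow> (\<forall>i\<in>I. act A (c i) (g i) = 0))"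

lemma krylov_sumI: "v = (\<Sum>i\<in>I. act A (c i) (g i)) \<Longrightarrow> v \<in> krylov_sum A I g"
  by (auto simp: krylov_sum_def)

lemma krylov_sumE:
  assumes "v \<in> krylov_sum A I g"
  obtains c where "v = (\<Sum>i\<in>I. act A (c i) (g i))"
  using assms by (auto simp: krylov_sum_def)

lemma submodule_krylov_sum: "submodule A (krylov_sum A I g)"
  unfolding submodule_def
proof (intro conjI ballI allI)
  show "0 \<in> krylov_sum A I g"
    by (rule krylov_sumI[of _ _ "\<lambda>_. 0"]) simp
next
  fix v w assume "v \<in> krylov_sum A I g" "w \<in> krylov_sum A I g"
  then obtain c d where "v = (\<Sum>i\<in>I. act A (c i) (g i))" "w = (\<Sum>i\<in>I. act A (d i) (g i))"
    by (blast elim: krylov_sumE)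
  then show "v + w \<in> krylov_sum A I g"
    by (intro krylov_sumI[of _ _ "\<lambda>i. c i + d i"]) (simp add: act_add_left sum.distrib)
next
  fix p v assume "v \<in> krylov_sum A I g"
  then obtain c where "v = (\<Sum>i\<in>I. act A (c i) (g i))"
    by (rule krylov_sumE)
  then show "act A p v \<in> krylov_sum A I g"
    by (intro krylov_sumI[of _ _ "\<lambda>i. p * c i"]) (simp add: act_mult act_sum_right)
qed

lemma krylov_sum_mono:
  assumes "finite J" and "I \<subseteq> J"
  shows "krylov_sum A I g \<subseteq> krylov_sum A J g"
proof
  fix v assume "v \<in> krylov_sum A I g"
  then obtain c where "v = (\<Sum>i\<in>I. act A (c i) (g i))"
    by (auto simp: krylov_sum_def)
  also have "\<dots> = (\<Sum>i\<in>J. act A (if i \<in> I then c i else 0) (g i))"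
    using assms by (intro sum.mono_neutral_cong_left) auto
  finally show "v \<in> krylov_sum A J g"
    by (rule krylov_sumI)
qed

lemma krylov_sum_insert:
  assumes "finite I" and "j \<notin> I"
  shows "krylov_sum A (insert j I) g = {x + y | x y. x \<in> krylov_space A (g j) \<and> y \<in> krylov_sum A I g}"
    (is "_ = ?R")
proof
  show "krylov_sum A (insert j I) g \<subseteq> ?R"
    using assms by (auto simp: krylov_sum_def krylov_space_eq)
  show "?R \<subseteq> krylov_sum A (insert j I) g"
  proof
    fix v assume "v \<in> ?R"
    then obtain p c where "v = act A p (g j) + (\<Sum>i\<in>I. act A (c i) (g i))"
      by (auto simp: krylov_sum_def krylov_space_eq)
    also have "(\<Sum>i\<in>I. act A (c i) (g i)) = (\<Sum>i\<in>I. act A ((c(j := p)) i) (g i))"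
      using assms by (intro sum.cong) auto
    also have "act A p (g j) + \<dots> = (\<Sum>i\<in>insert j I. act A ((c(j := p)) i) (g i))"
      using assms by simp
    finally show "v \<in> krylov_sum A (insert j I) g"
      by (rule krylov_sumI)
  qed
qed

lemma krylov_space_subset_krylov_sum:
  assumes "finite I" and "i \<in> I"
  shows "krylov_space A (g i) \<subseteq> krylov_sum A I g"
  using krylov_sum_mono[of I "{i}" A g] assms by (force simp: krylov_sum_def krylov_space_eq)

lemma mem_krylov_sum:
  assumes "finite I" and "i \<in> I"
  shows "g i \<in> krylov_sum A I g"
  using krylov_space_subset_krylov_sum[OF assms, where A = A and g = g] act_1[of A "g i"]
  by (metis krylov_space_eq rangeI subsetD)

lemma krylov_sum_subset:
  assumes "submodule A M" and "\<And>i. i \<in> I \<Longrightarrow> g i \<in> M"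
  shows "krylov_sum A I g \<subseteq> M"
  using assms by (auto simp: krylov_sum_def intro!: submodule_sum) (auto simp: submodule_def)

lemma act_image_krylov_sum: "act A p ` krylov_sum A I g = krylov_sum A I (\<lambda>i. act A p (g i))"
  by (auto simp: krylov_sum_def act_sum_right act_commute[of A p] image_image)

text \<open>The factor p is absorbed into the coefficients, so a relation among the images is a
  relation among the original generators.\<close>

lemma krylov_indep_act:
  assumes "krylov_indep A I g"
  shows "krylov_indep A I (\<lambda>i. act A p (g i))"
  unfolding krylov_indep_def
proof (intro allI impI)
  fix c assume "(\<Sum>i\<in>I. act A (c i) (act A p (g i))) = 0"
  then show "\<forall>i\<in>I. act A (c i) (act A p (g i)) = 0"
    using assms[unfolded krylov_indep_def, rule_format, of "\<lambda>i. c i * p"] by (simp add: act_mult)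
qed

text \<open>Generators are added one at a time. Independence makes the new Krylov space meet the sum
  of the others trivially, so dimensions add.\<close>

lemma dim_krylov_sum:
  assumes "finite I" and "krylov_indep A I g"
  shows "vec.dim (krylov_sum A I g) = (\<Sum>i\<in>I. vec.dim (krylov_space A (g i)))"
  using assms
proof (induction I)
  case empty
  then show ?case by (simp add: krylov_sum_def)
next
  case (insert j I)
  note indep = insert.prems[unfolded krylov_indep_def, rule_format]
  have "krylov_indep A I g"
    unfolding krylov_indep_def
  proof (intro allI impI ballI)
    fix c i assume "(\<Sum>i\<in>I. act A (c i) (g i)) = 0" "i \<in> I"
    moreover have "(\<Sum>i\<in>I. act A (c i) (g i)) = (\<Sum>i\<in>I. act A ((c(j := 0)) i) (g i))"
      using insert.hyps by (intro sum.cong) auto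
    ultimately show "act A (c i) (g i) = 0"
      using insert.hyps indep[of "c(j := 0)" i] by (auto split: if_splits)
  qed
  then have "vec.dim (krylov_sum A I g) = (\<Sum>i\<in>I. vec.dim (krylov_space A (g i)))"
    by (rule insert.IH)
  moreover have "vec.dim (krylov_space A (g j) \<inter> krylov_sum A I g) = 0"
  proof -
    have "krylov_space A (g j) \<inter> krylov_sum A I g \<subseteq> {0}"
    proof
      fix v assume "v \<in> krylov_space A (g j) \<inter> krylov_sum A I g"
      then obtain p c where v: "v = act A p (g j)" "v = (\<Sum>i\<in>I. act A (c i) (g i))"
        unfolding krylov_space_eq by (blast elim: krylov_sumE)
      \<comment> \<open>Giving g j the coefficient -p turns the two expressions for v into a single
        relation.\<close>
      have "(\<Sum>i\<in>I. act A ((c(j := - p)) i) (g i)) = v"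
        unfolding v(2) using insert.hyps by (intro sum.cong) auto
      then have "(\<Sum>i\<in>insert j I. act A ((c(j := - p)) i) (g i)) = 0"
        using insert.hyps v(1) by (simp add: act_uminus_left)
      then show "v \<in> {0}"
        using indep[of "c(j := - p)" j] v(1) by (simp add: act_uminus_left)
    qed
    then show ?thesis
      by simp
  qed
  moreover have "vec.subspace (krylov_space A (g j))"
    by (simp add: krylov_space_def)
  note vec.dim_sums_Int[OF this submodule_imp_subspace[OF submodule_krylov_sum[of A I g]]]
  ultimately show ?case
    using insert.hyps by (simp add: krylov_sum_insert del: vec.dim_eq_0)
qed

section \<open>Polynomial relations and the direct sum condition\<close>

lemma family_sum_krylov_space:
  assumes "finite S"
  shows "family_sum S (krylov_space A) = krylov_sum A S (\<lambda>b. b)"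
proof
  show "family_sum S (krylov_space A) \<subseteq> krylov_sum A S (\<lambda>b. b)"
  proof
    fix x assume "x \<in> family_sum S (krylov_space A)"
    then obtain J v where x: "x = (\<Sum>i\<in>J. v i)" "J \<subseteq> S" "\<And>i. i \<in> J \<Longrightarrow> v i \<in> krylov_space A i"
      unfolding family_sum_def by blast
    show "x \<in> krylov_sum A S (\<lambda>b. b)"
      unfolding x(1)
    proof (rule submodule_sum[OF submodule_krylov_sum])
      fix i assume "i \<in> J"
      then show "v i \<in> krylov_sum A S (\<lambda>b. b)"
        using krylov_space_subset_krylov_sum[of S i A "\<lambda>b. b"] x(2,3) assms by blast
    qed
  qed
  show "krylov_sum A S (\<lambda>b. b) \<subseteq> family_sum S (krylov_space A)"
  proof
    fix x assume "x \<in> krylov_sum A S (\<lambda>b. b)"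
    then obtain c where "x = (\<Sum>i\<in>S. act A (c i) i)"
      by (rule krylov_sumE)
    moreover have "act A (c i) i \<in> krylov_space A i" for i
      unfolding krylov_space_eq by blast
    ultimately show "x \<in> family_sum S (krylov_space A)"
      unfolding family_sum_def using assms by blast
  qed
qed

text \<open>Moving one term of a relation to the other side exhibits a vector common to one Krylov
  space and the sum of the others, and conversely.\<close>

lemma jordan_krylov_independent_iff:
  "jordan_krylov_independent A S \<longleftrightarrow> finite S \<and> krylov_indep A S (\<lambda>b. b)"
proof (cases "finite S")
  case True
  have zero: "0 \<in> krylov_sum A J g" "0 \<in> krylov_space A b" for J b and g :: "'a^'b \<Rightarrow> 'a^'b"
    using submodule_krylov_sum[of A J g] by (simp_all add: submodule_def krylov_space_def vec.span_zero)
  have "direct_sum_condition S (krylov_space A)" if indep: "krylov_indep A S (\<lambda>b. b)"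
    unfolding direct_sum_condition_def
  proof
    fix b assume b: "b \<in> S"
    have "v = 0" if v: "v \<in> krylov_sum A (S - {b}) (\<lambda>b. b)" "v \<in> krylov_space A b" for v
    proof -
      obtain p c where v: "v = act A p b" "v = (\<Sum>i\<in>S - {b}. act A (c i) i)"
        using v unfolding krylov_space_eq by (blast elim: krylov_sumE)
      have "(\<Sum>i\<in>S - {b}. act A ((c(b := - p)) i) i) = v"
        unfolding v(2) by (intro sum.cong) auto
      then have "(\<Sum>i\<in>S. act A ((c(b := - p)) i) i) = 0"
        using v(1) by (simp add: sum.remove[OF True b] act_uminus_left)
      then show "v = 0"
        using indep[unfolded krylov_indep_def, rule_format, of "c(b := - p)" b] b v(1)
        by (simp add: act_uminus_left)
    qed
    then show "family_sum (S - {b}) (krylov_space A) \<inter> krylov_space A b = {0}"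
      using zero True by (auto simp: family_sum_krylov_space)
  qed
  moreover have "krylov_indep A S (\<lambda>b. b)" if dir: "direct_sum_condition S (krylov_space A)"
    unfolding krylov_indep_def
  proof (intro allI impI ballI)
    fix c b assume *: "(\<Sum>i\<in>S. act A (c i) i) = 0" "b \<in> S"
    then have "act A (c b) b = - (\<Sum>i\<in>S - {b}. act A (c i) i)"
      by (simp add: sum.remove[OF True *(2)] eq_neg_iff_add_eq_0)
    also have "\<dots> = (\<Sum>i\<in>S - {b}. act A (- c i) i)"
      by (simp add: act_uminus_left sum_negf)
    also have "\<dots> \<in> krylov_sum A (S - {b}) (\<lambda>b. b)"
      by (rule krylov_sumI) simp
    finally have "act A (c b) b \<in> family_sum (S - {b}) (krylov_space A)"
      using True by (simp add: family_sum_krylov_space)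
    moreover have "act A (c b) b \<in> krylov_space A b"
      by (auto simp: krylov_space_eq)
    ultimately show "act A (c b) b = 0"
      using dir *(2) unfolding direct_sum_condition_def by blast
  qed
  ultimately show ?thesis
    using True by (auto simp: jordan_krylov_independent_def)
qed (simp add: jordan_krylov_independent_def)

lemma jordan_krylov_basis_iff:
  "jordan_krylov_basis A W B \<longleftrightarrow>
     finite B \<and> W = krylov_sum A B (\<lambda>b. b) \<and> krylov_indep A B (\<lambda>b. b)"
  using mem_krylov_sum[of B _ "\<lambda>b. b" A]
  by (auto simp: jordan_krylov_basis_def krylov_generating_def jordan_krylov_independent_iff
      family_sum_krylov_space)

section \<open>Existence of a basis\<close>

text \<open>Applying f to a relation gives one among the independent images, so each coefficient
  kills a nonzero primary vector and is divisible by f. Moving these factors f onto the generators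
  makes the original relation one among the images.\<close>

lemma krylov_indep_lift:
  assumes f: "irreducible f"
    and indep: "krylov_indep A I (\<lambda>i. act A f (g i))"
    and nz: "\<And>i. i \<in> I \<Longrightarrow> act A f (g i) \<noteq> 0"
    and primary: "\<And>i. i \<in> I \<Longrightarrow> act A (f ^ L) (act A f (g i)) = 0"
  shows "krylov_indep A I g"
  unfolding krylov_indep_def
proof (intro allI impI)
  fix c assume c: "(\<Sum>i\<in>I. act A (c i) (g i)) = 0"
  have "(\<Sum>i\<in>I. act A (c i) (act A f (g i))) = act A f (\<Sum>i\<in>I. act A (c i) (g i))"
    by (simp add: act_sum_right act_commute[of A f])
  then have "act A (c i) (act A f (g i)) = 0" if "i \<in> I" for i
    using indep that c unfolding krylov_indep_def by simp
  then have "f dvd c i" if "i \<in> I" for i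
    using primary_annihilator[OF f] primary nz that by blast
  then obtain q where q: "c i = q i * f" if "i \<in> I" for i
    unfolding dvd_def by (metis mult.commute)
  have "(\<Sum>i\<in>I. act A (q i) (act A f (g i))) = 0"
    using c q by (simp add: act_mult)
  then show "\<forall>i\<in>I. act A (c i) (g i) = 0"
    using indep q unfolding krylov_indep_def by (simp add: act_mult)
qed

text \<open>If f did not divide the coefficient of w, that coefficient would be invertible modulo f,
  and the relation could be solved for w inside the old sum. So f divides it, and the term of w
  vanishes.\<close>

lemma krylov_indep_insert:
  assumes f: "irreducible f" and fin: "finite B" and indep: "krylov_indep A B (\<lambda>b. b)"
    and w: "act A f w = 0" "w \<notin> krylov_sum A B (\<lambda>b. b)"
  shows "krylov_indep A (insert w B) (\<lambda>b. b)"
  unfolding krylov_indep_def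
proof (intro allI impI)
  fix c assume c: "(\<Sum>b\<in>insert w B. act A (c b) b) = 0"
  have "w \<notin> B"
    using w(2) mem_krylov_sum[OF fin, of w "\<lambda>b. b"] by blast
  then have sum: "act A (c w) w + (\<Sum>b\<in>B. act A (c b) b) = 0"
    using c fin by simp
  have "f dvd c w"
  proof (rule ccontr)
    assume "\<not> f dvd c w"
    then obtain a d where ad: "a * c w + d * f = 1"
      using irreducible_bezout[OF f] by blast
    have "w = act A (a * c w + d * f) w"
      by (simp add: ad)
    also have "\<dots> = act A a (act A (c w) w)"
      using w(1) by (simp add: act_add_left act_mult)
    also have "\<dots> = act A (- a) (\<Sum>b\<in>B. act A (c b) b)"
      using sum act_diff_right[of A a 0 "\<Sum>b\<in>B. act A (c b) b"]
      by (simp add: act_uminus_left flip: eq_neg_iff_add_eq_0)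
    also have "\<dots> \<in> krylov_sum A B (\<lambda>b. b)"
      using submodule_krylov_sum[of A B "\<lambda>b. b"] unfolding submodule_def krylov_sum_def by blast
    finally show False using w(2) by blast
  qed
  then obtain q where "c w = q * f"
    by (metis dvd_def mult.commute)
  then have "act A (c w) w = 0"
    using w(1) by (simp add: act_mult)
  then show "\<forall>b\<in>insert w B. act A (c b) b = 0"
    using sum indep unfolding krylov_indep_def by simp
qed

text \<open>A vector killed by \<open>f(A)\<close> generates a simple module, which a sum of Krylov spaces either
  contains or meets trivially; so a sum of maximal dimension contains \<open>M \<inter> ker f(A)\<close>.\<close>

lemma krylov_basis_exists:
  fixes A :: "'k::field^'n^'n"
  assumes f: "irreducible f" and "submodule A M" and "\<And>v. v \<in> M \<Longrightarrow> act A (f ^ L) v = 0"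
  shows "\<exists>B. finite B \<and> 0 \<notin> B \<and> krylov_indep A B (\<lambda>b. b) \<and> M = krylov_sum A B (\<lambda>b. b)"
  using assms(2,3)
proof (induction L arbitrary: M)
  case 0
  then have "M = {0}" by (auto simp: submodule_def)
  then show ?case
    by (intro exI[of _ "{}"]) (simp add: krylov_indep_def krylov_sum_def)
next
  case (Suc L)
  note M = Suc.prems(1)
  have killed: "act A (f ^ L) v = 0" if "v \<in> act A f ` M" for v
    using that Suc.prems(2) by (auto simp only: act_power_act)
  \<comment> \<open>One power of f fewer kills f(A) M. That \<open>0 \<notin> C\<close> supplies the
    nonzero images required by \<open>krylov_indep_lift\<close>.\<close>
  obtain C where C: "finite C" "0 \<notin> C" "krylov_indep A C (\<lambda>b. b)"
    and fM: "act A f ` M = krylov_sum A C (\<lambda>b. b)"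
    using Suc.IH[OF submodule_act_image[OF M, of f] killed] by auto
  have "\<exists>v\<in>M. act A f v = b" if "b \<in> C" for b
    using mem_krylov_sum[OF C(1) that, of "\<lambda>b. b" A] unfolding fM[symmetric] by force
  then obtain g where g: "g b \<in> M" "act A f (g b) = b" if "b \<in> C" for b
    by metis
  have inj: "inj_on g C"
    using g(2) by (metis inj_onI)
  have "krylov_indep A (g ` C) (\<lambda>b. b)"
  proof (rule krylov_indep_lift[OF f])
    show "krylov_indep A (g ` C) (\<lambda>b. act A f b)"
      unfolding krylov_indep_def
    proof (intro allI impI)
      fix c assume "(\<Sum>b\<in>g ` C. act A (c b) (act A f b)) = 0"
      then have "(\<Sum>b\<in>C. act A (c (g b)) b) = 0"
        by (simp add: sum.reindex[OF inj] g(2))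
      then show "\<forall>b\<in>g ` C. act A (c b) (act A f b) = 0"
        using C(3)[unfolded krylov_indep_def, rule_format, of "\<lambda>b. c (g b)"] by (simp add: g(2))
    qed
    show "act A (f ^ L) (act A f v) = 0" if "v \<in> g ` C" for v
      using that g(1) Suc.prems(2) by (auto simp only: act_power_act)
  qed (use C g(2) in auto)
  moreover have "0 \<notin> g ` C"
    using C(2) g(2) by force
  \<comment> \<open>The candidates are the independent extensions of the lifted basis inside M;
    their sums have dimension at most that of K^n, so a maximum is attained.\<close>
  moreover define P where
    "P B \<longleftrightarrow> finite B \<and> B \<subseteq> M \<and> 0 \<notin> B \<and> krylov_indep A B (\<lambda>b. b) \<and> g ` C \<subseteq> B" for B
  ultimately have "P (g ` C)"
    using C(1) g(1) by blast
  moreover have "vec.dim (krylov_sum A B (\<lambda>b. b)) < Suc (vec.dim (UNIV :: ('k^'n) set))" for B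
    unfolding less_Suc_eq_le by (rule vec.dim_subset) simp
  ultimately obtain B where "P B" and max:
      "\<And>B'. P B' \<Longrightarrow> vec.dim (krylov_sum A B' (\<lambda>b. b)) \<le> vec.dim (krylov_sum A B (\<lambda>b. b))"
    using ex_has_greatest_nat[of P _ "\<lambda>B. vec.dim (krylov_sum A B (\<lambda>b. b))"] by blast
  then have B: "finite B" "B \<subseteq> M" "0 \<notin> B" "krylov_indep A B (\<lambda>b. b)" "g ` C \<subseteq> B"
    by (simp_all add: P_def)
  let ?N = "krylov_sum A B (\<lambda>b. b)"
  have N: "vec.subspace ?N"
    by (rule submodule_imp_subspace[OF submodule_krylov_sum])
  have ker: "w \<in> ?N" if w: "w \<in> M" "act A f w = 0" for w
  proof (rule ccontr)
    assume "w \<notin> ?N"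
    let ?N' = "krylov_sum A (insert w B) (\<lambda>b. b)"
    have "w \<noteq> 0"
      using \<open>w \<notin> ?N\<close> N vec.subspace_0 by blast
    \<comment> \<open>Adjoining w gives another candidate, so by maximality the sum cannot
      grow.\<close>
    then have "vec.dim ?N' \<le> vec.dim ?N"
      using B w krylov_indep_insert[OF f B(1,4) w(2) \<open>w \<notin> ?N\<close>] by (intro max) (auto simp: P_def)
    moreover have "?N \<subseteq> ?N'"
      using B(1) by (intro krylov_sum_mono) auto
    ultimately have "?N = ?N'"
      using N submodule_imp_subspace[OF submodule_krylov_sum[of A "insert w B" "\<lambda>b. b"]]
      by (intro vec.subspace_dim_equal) auto
    then show False
      using \<open>w \<notin> ?N\<close> mem_krylov_sum[of "insert w B" w "\<lambda>b. b" A] B(1) by simp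
  qed
  have "M \<subseteq> ?N"
  proof
    fix x assume x: "x \<in> M"
    then have "act A f x \<in> krylov_sum A C (\<lambda>b. b)"
      using fM by blast
    then obtain c where "act A f x = (\<Sum>b\<in>C. act A (c b) b)"
      by (auto simp: krylov_sum_def)
    \<comment> \<open>Replacing each b by its lift gives a vector with the same image as x, so their
      difference is in M and killed by f(A), hence lies in the sum.\<close>
    also have "\<dots> = act A f (\<Sum>b\<in>C. act A (c b) (g b))"
      by (simp add: act_sum_right act_commute[of A f] g(2))
    finally have y: "act A f (x - (\<Sum>b\<in>C. act A (c b) (g b))) = 0"
      by (simp add: act_diff_right)
    have "(\<Sum>b\<in>C. act A (c b) (g b)) \<in> M"
      using M g(1) by (intro submodule_sum[OF M]) (auto simp: submodule_def)
    then have "x - (\<Sum>b\<in>C. act A (c b) (g b)) \<in> ?N"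
      using x y by (intro ker) (auto intro: vec.subspace_diff[OF submodule_imp_subspace[OF M]])
    moreover have "(\<Sum>b\<in>C. act A (c b) (g b)) \<in> ?N"
    proof (intro submodule_sum[OF submodule_krylov_sum])
      fix b assume "b \<in> C"
      then have "g b \<in> ?N"
        using B(1,5) by (intro mem_krylov_sum[where g = "\<lambda>b. b"]) auto
      then show "act A (c b) (g b) \<in> ?N"
        using submodule_krylov_sum[of A B "\<lambda>b. b"] unfolding submodule_def by blast
    qed
    ultimately show "x \<in> ?N"
      using vec.subspace_add[OF N] by fastforce
  qed
  then have "M = ?N"
    using krylov_sum_subset[OF M, of B "\<lambda>b. b"] B(2) by blast
  then show ?case using B by blast
qed

section \<open>Uniqueness of the rank distribution\<close>

text \<open>For a vector killed by some power of f this extends rank_f, with value 0 exactly at the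
  zero vector.\<close>

definition f_order :: "'k::field^'n^'n \<Rightarrow> 'k poly \<Rightarrow> 'k^'n \<Rightarrow> nat" where
  "f_order A f v = (LEAST s. act A (f ^ s) v = 0)"

lemma act_power_eq_0_iff:
  assumes "act A (f ^ L) v = 0"
  shows "act A (f ^ s) v = 0 \<longleftrightarrow> f_order A f v \<le> s"
proof
  show "act A (f ^ s) v = 0 \<Longrightarrow> f_order A f v \<le> s"
    unfolding f_order_def by (rule Least_le)
  have least: "act A (f ^ f_order A f v) v = 0"
    using LeastI[of "\<lambda>s. act A (f ^ s) v = 0", OF assms] by (simp add: f_order_def)
  assume "f_order A f v \<le> s"
  then have "f ^ s = f ^ (s - f_order A f v) * f ^ f_order A f v"
    by (simp flip: power_add)
  then show "act A (f ^ s) v = 0"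
    by (simp add: act_mult least)
qed

lemma has_rank_iff_f_order:
  assumes "act A (f ^ L) v = 0" and "1 \<le> l"
  shows "has_rank A f v l \<longleftrightarrow> f_order A f v = l"
  \<comment> \<open>As l is positive, l - 1 is a genuine predecessor: order at most l but not at
    most l - 1 means order l.\<close>
  using assms(2) by (auto simp: has_rank_def mem_ker_pow_iff act_power_eq_0_iff[OF assms(1)])

text \<open>Applying f^j lowers the order by j, stopping at 0, which is truncated
  subtraction.\<close>

lemma dim_krylov_space_act_power:
  assumes f: "irreducible f" and v: "act A (f ^ L) v = 0"
  shows "vec.dim (krylov_space A (act A (f ^ j) v)) = degree f * (f_order A f v - j)"
proof (cases "f_order A f v \<le> j")
  case True
  then have "act A (f ^ j) v = 0"
    by (simp add: act_power_eq_0_iff[OF v])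
  moreover have "krylov_space A (0 :: 'a^'b) = {0}"
    by (auto simp: krylov_space_eq)
  ultimately show ?thesis
    using True by simp
next
  case False
  then obtain r where r: "f_order A f v = Suc r + j"
    by (metis less_imp_Suc_add linorder_not_le add.commute add_Suc_right)
  then have "act A (f ^ Suc r) (act A (f ^ j) v) = 0" "act A (f ^ r) (act A (f ^ j) v) \<noteq> 0"
    by (simp_all add: act_power_eq_0_iff[OF v] flip: act_mult power_add del: power_Suc)
  then show ?thesis
    using dim_krylov_space[OF f] r by simp
qed

text \<open>The image is generated by the vectors f(A)^j b, which stay independent even when some
  vanish, so the dimensions of their Krylov spaces add.\<close>

lemma dim_act_power_image:
  assumes "irreducible f" and "finite B" and "krylov_indep A B (\<lambda>b. b)"
    and "\<And>b. b \<in> B \<Longrightarrow> act A (f ^ L) b = 0"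
  shows "vec.dim (act A (f ^ j) ` krylov_sum A B (\<lambda>b. b)) =
    degree f * (\<Sum>b\<in>B. f_order A f b - j)"
  using assms krylov_indep_act[OF assms(3)]
  by (simp add: act_image_krylov_sum dim_krylov_sum dim_krylov_space_act_power[OF assms(1) assms(4)]
      sum_distrib_left)

text \<open>The number of elements of value \<open>l\<close> is a second difference of \<open>j \<mapsto> \<Sum>b\<in>B. r b - j\<close>,
  where the subtraction is truncated.\<close>

lemma card_eq_second_difference:
  fixes r :: "'b \<Rightarrow> nat"
  assumes "finite B" and "1 \<le> l"
  shows "int (card {b \<in> B. r b = l}) =
    int (\<Sum>b\<in>B. r b - (l - 1)) - 2 * int (\<Sum>b\<in>B. r b - l) + int (\<Sum>b\<in>B. r b - (l + 1))"
proof -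
  have "int (card {b \<in> B. r b = l}) = (\<Sum>b\<in>B. if r b = l then 1 else 0)"
    using assms(1) by (simp add: sum.If_cases Int_def)
  \<comment> \<open>Termwise: all three parts vanish for r b < l, they cancel by linearity for r b >
    l, and at r b = l they give 1 - 0 + 0.\<close>
  also have "\<dots> = (\<Sum>b\<in>B. int (r b - (l - 1)) - 2 * int (r b - l) + int (r b - (l + 1)))"
    using assms(2) by (intro sum.cong) auto
  finally show ?thesis
    by (simp add: sum.distrib sum_subtractf sum_distrib_left)
qed

lemma card_has_rank_unique:
  assumes f: "irreducible f" and l: "1 \<le> l"
    and B: "jordan_krylov_basis A (ker_pow A f L) B"
    and B': "jordan_krylov_basis A (ker_pow A f L) B'"
  shows "card {b \<in> B. has_rank A f b l} = card {b \<in> B'. has_rank A f b l}"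
proof -
  have ker: "act A (f ^ L) b = 0" if "jordan_krylov_basis A (ker_pow A f L) S" "b \<in> S" for S b
    using that mem_krylov_sum[of S b "\<lambda>b. b" A] mem_ker_pow_iff[of b A f L]
    by (simp add: jordan_krylov_basis_iff)
  have dim: "vec.dim (act A (f ^ j) ` ker_pow A f L) = degree f * (\<Sum>b\<in>S. f_order A f b - j)"
    if S: "jordan_krylov_basis A (ker_pow A f L) S" for S j
    using dim_act_power_image[OF f _ _ ker[OF S]] S by (simp add: jordan_krylov_basis_iff)
  have "degree f \<noteq> 0"
    using f by (auto simp: irreducible_def is_unit_iff_degree)
  \<comment> \<open>The dimension on the left of \<open>dim\<close> mentions no basis, and f is
    nonconstant, so its degree cancels.\<close>
  then have eq: "(\<Sum>b\<in>B. f_order A f b - j) = (\<Sum>b\<in>B'. f_order A f b - j)" for j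
    using dim[OF B] dim[OF B'] by (metis mult_left_cancel)
  have rank: "{b \<in> S. has_rank A f b l} = {b \<in> S. f_order A f b = l}"
    if S: "jordan_krylov_basis A (ker_pow A f L) S" for S
    using has_rank_iff_f_order[OF ker[OF S] l] by blast
  have "int (card {b \<in> B. f_order A f b = l}) = int (card {b \<in> B'. f_order A f b = l})"
    using B B' l by (simp only: card_eq_second_difference jordan_krylov_basis_iff eq)
  then show ?thesis
    by (simp add: rank[OF B] rank[OF B'])
qed

section \<open>Existence and uniqueness for the generalized kernel\<close>

theorem theorem12:
  fixes \<iota> :: "'k::field \<Rightarrow> complex"
    and A :: "'k^'n^'n"
    and f :: "'k poly"
    and lbar :: nat
  assumes "complex_field_embedding \<iota>"
    and "lead_coeff f = 1"
    and "irreducible f"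
    and "f dvd charpoly A"
    and "lbar = factor_multiplicity f (minpoly A)"
  shows "(\<exists>B. jordan_krylov_basis A (ker_pow A f lbar) B) \<and>
    (\<forall>l. 1 \<le> l \<and> l \<le> lbar \<longrightarrow>
      (\<forall>B B'. jordan_krylov_basis A (ker_pow A f lbar) B \<and>
              jordan_krylov_basis A (ker_pow A f lbar) B' \<longrightarrow>
        card {b \<in> B. has_rank A f b l} = card {b \<in> B'. has_rank A f b l}))"
proof (intro conjI allI impI)
  obtain B where "finite B" "krylov_indep A B (\<lambda>b. b)"
    "ker_pow A f lbar = krylov_sum A B (\<lambda>b. b)"
    using krylov_basis_exists[OF assms(3) submodule_ker_pow, of A f lbar lbar]
    by (auto simp: mem_ker_pow_iff)
  then show "\<exists>B. jordan_krylov_basis A (ker_pow A f lbar) B"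
    unfolding jordan_krylov_basis_iff by blast
next
  fix l B B'
  assume "1 \<le> l \<and> l \<le> lbar"
    and "jordan_krylov_basis A (ker_pow A f lbar) B \<and>
      jordan_krylov_basis A (ker_pow A f lbar) B'"
  then show "card {b \<in> B. has_rank A f b l} = card {b \<in> B'. has_rank A f b l}"
    using card_has_rank_unique[OF assms(3)] by blast
qed

end
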